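(* Consider the network and the two optimization problems $(\mathrm{L}:\mathcal{SC}(\boldsymbol\xi_i,\boldsymbol\zeta_{\mathcal N_i}),\mathcal F(\mathbb R^{N_{x,i}}))$ (local information exchange) and $(\mathrm{PN}:\mathcal{SC}(\boldsymbol\xi_{\overline{\mathcal N}_i}))$ (partially nested information exchange) defined in the context. Then $(\mathrm{L}:\mathcal{SC}(\boldsymbol\xi_i,\boldsymbol\zeta_{\mathcal N_i}),\mathcal F(\mathbb R^{N_{x,i}}))$ is a conservative approximation of $(\mathrm{PN}:\mathcal{SC}(\boldsymbol\xi_{\overline{\mathcal N}_i}))$ in the following sense: every feasible solution $(\boldsymbol\Psi_i,\mathcal X_i)_{i\in\mathcal M}$ of the former is feasible in the latter, i.e. the policies $u_{i,t}=\Psi_{i,t}(\boldsymbol\xi_i^{t-1},\boldsymbol x_{\mathcal N_i}^t)$ obtained by evaluating the beliefs $\boldsymbol\zeta_{\mathcal N_i}$ at the actual neighbor states $\boldsymbol x_{\mathcal N_i}$ generated by the network dynamics, which are policies of the form $u_{i,t}=\Phi_{i,t}(\boldsymbol\xi_{\overline{\mathcal N}_i}^{t-1})$, are feasible in $(\mathrm{PN}:\mathcal{SC}(\boldsymbol\xi_{\overline{\mathcal N}_i}))$; and the optimal value of $(\mathrm{L}:\mathcal{SC}(\boldsymbol\xi_i,\boldsymbol\zeta_{\mathcal N_i}),\mathcal F(\mathbb R^{N_{x,i}}))$ is equal to or larger than the optimal value of $(\mathrm{PN}:\mathcal{SC}(\boldsymbol\xi_{\overline{\mathcal N}_i}))$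.
   Context: **Network.** Let $M,T\in\mathbb N$, $\mathcal M=\{1,\dots,M\}$, $\mathcal T=\{1,\dots,T\}$, $\mathcal T_+=\{1,\dots,T+1\}$. Agents $i\in\mathcal M$ are the nodes of a directed graph; $\mathcal N_i\subset\mathcal M$ is the set of agents $j$ with an arc from $j$ to $i$ (neighbors of $i$). $\overline{\mathcal N}_i\subseteq\mathcal M$ consists of $i$ and all its precedent agents, i.e. all $j$ from which there is a directed path to $i$; in particular $\overline{\mathcal N}_j\subseteq\overline{\mathcal N}_i$ for $j\in\mathcal N_i$. **Notation.** For a set of agents $\mathcal A$, a subscript $\mathcal A$ denotes concatenation over $i\in\mathcal A$; for a time-dependent vector $\nu_{i,t}$, $\boldsymbol\nu_i^t=(\nu_{i,1},\dots,\nu_{i,t})$ is its history up to time $t$ (empty for $t=0$), and $\boldsymbol\nu_{\mathcal A}^t=[\boldsymbol\nu_i^t]_{i\in\mathcal A}$. **Dynamics, constraints, cost.** Agent $i$ has states $x_{i,t}\in\mathbb R^{n_{x,i}}$ ($t\in\mathcal T_+$, $x_{i,1}$ known), inputs $u_{i,t}\in\mathbb R^{n_{u,i}}$, disturbances $\xi_{i,t}\in\mathbb R^{n_{\xi,i}}$ ($t\in\mathcal T$). Known matrices $A_{i,t},B_{i,t},D_{i,t},E_{i,t}$ of full column rank are given. $\boldsymbol x_i=f_i(\boldsymbol x_{\mathcal N_i},\boldsymbol u_i,\boldsymbol\xi_i)$ means $$x_{i,t+1}=A_{i,t}x_{i,t}+B_{i,t}\boldsymbol x_{\mathcal N_i,t}+D_{i,t}u_{i,t}+E_{i,t}\xi_{i,t},\quad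 t\in\mathcal T,$$ and $\boldsymbol x_i=f_i(\boldsymbol\zeta_{\mathcal N_i},\boldsymbol u_i,\boldsymbol\xi_i)$ is the same with $\boldsymbol\zeta_{\mathcal N_i,t}$ in place of $\boldsymbol x_{\mathcal N_i,t}$. Here $\boldsymbol x_i=[x_{i,t}]_{t\in\mathcal T_+}\in\mathbb R^{N_{x,i}}$, $N_{x,i}=(T+1)n_{x,i}$, $\boldsymbol u_i=[u_{i,t}]_{t\in\mathcal T}$, $\boldsymbol\xi_i=[\xi_{i,t}]_{t\in\mathcal T}$. Operational constraints: $\mathcal O_i=\{(\boldsymbol x_i,\boldsymbol u_i): H_{x,i}\boldsymbol x_i+H_{u,i}\boldsymbol u_i\le h_i\}$. Cost: $J_i(\boldsymbol x_i,\boldsymbol u_i)=\sum_{t=1}^T(\|Q_ix_{i,t}\|_p+\|R_iu_{i,t}\|_p)$, $p\in\{1,2,\infty\}$. Disturbances: $\boldsymbol\xi_i\in\Xi_i$, a nonempty compact polyhedron; $\Xi_{\mathcal A}=\prod_{i\in\mathcal A}\Xi_i$. **Problem $(\mathrm{PN}:\mathcal{SC}(\boldsymbol\xi_{\overline{\mathcal N}_i}))$:** minimize $\sum_{i=1}^M\max_{\boldsymbol\xi_{\overline{\mathcal N}_i}\in\Xi_{\overline{\mathcal N}_i}}J_i(\boldsymbol x_i,\boldsymbol u_i)$ over strictly causal policies $\boldsymbol\Phi_i=[\Phi_{i,t}]_{t\in\mathcal T}$, $u_{i,t}=\Phi_{i,t}(\boldsymbol\xi_{\overline{\mathcal N}_i}^{t-1})$,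 $i\in\mathcal M$ (arbitrary functions; this set is $\mathcal{SC}(\boldsymbol\xi_{\overline{\mathcal N}_i})$), subject to $\boldsymbol x_i=f_i(\boldsymbol x_{\mathcal N_i},\boldsymbol u_i,\boldsymbol\xi_i)$ and $(\boldsymbol x_i,\boldsymbol u_i)\in\mathcal O_i$ for all $\boldsymbol\xi_{\overline{\mathcal N}_i}\in\Xi_{\overline{\mathcal N}_i}$ and all $i\in\mathcal M$ (the trajectories are generated jointly by all agents' policies). **Problem $(\mathrm{L}:\mathcal{SC}(\boldsymbol\xi_i,\boldsymbol\zeta_{\mathcal N_i}),\mathcal F(\mathbb R^{N_{x,i}}))$:** $\mathcal F(\mathbb R^{N_{x,i}})$ is the collection of nonempty compact subsets of $\mathbb R^{N_{x,i}}$; state forecast sets are $\mathcal X_i\in\mathcal F(\mathbb R^{N_{x,i}})$, with $\mathcal X_{\mathcal N_i}=\prod_{j\in\mathcal N_i}\mathcal X_j$; beliefs $\boldsymbol\zeta_j=[\zeta_{j,t}]_{t\in\mathcal T_+}$ range over $\mathcal X_j$. Policies $\boldsymbol\Psi_i=[\Psi_{i,t}]_{t\in\mathcal T}\in\mathcal{SC}(\boldsymbol\xi_i,\boldsymbol\zeta_{\mathcal N_i})$ are families of functions giving $u_{i,t}=\Psi_{i,t}(\boldsymbol\xi_i^{t-1},\boldsymbol\zeta_{\mathcal N_i}^t)$. Minimize $\sum_{i=1}^M\max_{\boldsymbol\xi_i\in\Xi_i,\,\boldsymbol\zeta_{\mathcal N_i}\in\mathcal X_{\mathcal N_i}}J_i(\boldsymbol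 x_i,\boldsymbol u_i)$ over $\boldsymbol\Psi_i$ and $\mathcal X_i$, $i\in\mathcal M$, subject to, for all $i\in\mathcal M$, $\boldsymbol\xi_i\in\Xi_i$, $\boldsymbol\zeta_{\mathcal N_i}\in\mathcal X_{\mathcal N_i}$: $\boldsymbol u_i=\boldsymbol\Psi_i(\boldsymbol\xi_i,\boldsymbol\zeta_{\mathcal N_i})$, $\boldsymbol x_i=f_i(\boldsymbol\zeta_{\mathcal N_i},\boldsymbol u_i,\boldsymbol\xi_i)$, $(\boldsymbol x_i,\boldsymbol u_i)\in\mathcal O_i$, $\boldsymbol x_i\in\mathcal X_i$. **Conventions.** "max" is read as supremum; the optimal value is the infimum of the objective over feasible solutions, $+\infty$ if there are none. *)

theory Defs
  imports "HOL-Library.Extended_Real" "HOL-Analysis.Abstract_Euclidean_Space" "Jordan_Normal_Form.DL_Rank"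
begin

section \<open>Vectors of variable dimension\<close>

text \<open>The dimensions depend on the agent, so $\mathbb{R}^n$ is \<^term>\<open>carrier_vec n\<close>. Its usual
  topology is transported from \<^const>\<open>Euclidean_space\<close> along zero padding, which is a bijection
  onto the topological space \<^term>\<open>Euclidean_space n\<close>.\<close>

definition vec_topology :: "nat \<Rightarrow> real vec topology" where
  "vec_topology n =
     pullback_topology (carrier_vec n) (\<lambda>v k. if k < n then vec_index v k else 0) (Euclidean_space n)"

lemma topspace_vec_topology [simp]: "topspace (vec_topology n) = carrier_vec n"
  by (auto simp: vec_topology_def topspace_pullback_topology topspace_Euclidean_space)

text \<open>The order on vectors is componentwise.\<close>

definition polyhedron_vec :: "nat \<Rightarrow> real vec set \<Rightarrow> bool" where
  "polyhedron_vec n P \<longleftrightarrow>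
     (\<exists>m W w. W \<in> carrier_mat m n \<and> w \<in> carrier_vec m \<and> P = {v \<in> carrier_vec n. W *\<^sub>v v \<le> w})"

definition full_column_rank :: "real mat \<Rightarrow> bool" where
  "full_column_rank A \<longleftrightarrow> vec_space.rank (dim_row A) A = dim_col A"

definition pnorm :: "ereal \<Rightarrow> real vec \<Rightarrow> real" where
  "pnorm p v =
     (if p = \<infinity> then Max (insert 0 ((\<lambda>k. \<bar>vec_index v k\<bar>) ` {..<dim_vec v}))
      else (\<Sum>k<dim_vec v. \<bar>vec_index v k\<bar> powr real_of_ereal p) powr (1 / real_of_ereal p))"

definition concat_vec :: "real vec list \<Rightarrow> real vec" where
  "concat_vec vs = foldr (@\<^sub>v) vs vNil"

text \<open>A trajectory $\nu = [\nu_t]_t$ of vectors $\nu_t\in\mathbb{R}^n$ is the stacked vector.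
  Time starts at 1; \<^term>\<open>block n v t\<close> recovers $\nu_t$.\<close>

definition block :: "nat \<Rightarrow> real vec \<Rightarrow> nat \<Rightarrow> real vec" where
  "block n v t = vec n (\<lambda>k. vec_index v ((t - 1) * n + k))"

definition history :: "nat \<Rightarrow> real vec \<Rightarrow> nat \<Rightarrow> real vec list" where
  "history n v t = map (block n v) [1..<Suc t]"

definition histories :: "nat \<Rightarrow> nat \<Rightarrow> real vec list set" where
  "histories n t = {vs. length vs = t \<and> set vs \<subseteq> carrier_vec n}"


section \<open>Network\<close>

record network =
  num_agents :: nat
  horizon :: nat
  arcs :: "(nat \<times> nat) set"
  dim_x :: "nat \<Rightarrow> nat"
  dim_u :: "nat \<Rightarrow> nat"
  dim_xi :: "nat \<Rightarrow> nat"
  x_init :: "nat \<Rightarrow> real vec"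
  mat_A :: "nat \<Rightarrow> nat \<Rightarrow> real mat"
  mat_B :: "nat \<Rightarrow> nat \<Rightarrow> real mat"
  mat_D :: "nat \<Rightarrow> nat \<Rightarrow> real mat"
  mat_E :: "nat \<Rightarrow> nat \<Rightarrow> real mat"
  mat_Hx :: "nat \<Rightarrow> real mat"
  mat_Hu :: "nat \<Rightarrow> real mat"
  vec_h :: "nat \<Rightarrow> real vec"
  mat_Q :: "nat \<Rightarrow> real mat"
  mat_R :: "nat \<Rightarrow> real mat"
  norm_p :: ereal
  Xi :: "nat \<Rightarrow> real vec set"

definition agents :: "network \<Rightarrow> nat set" where
  "agents S = {1..num_agents S}"

definition time_steps :: "network \<Rightarrow> nat set" where
  "time_steps S = {1..horizon S}"

definition neighbors :: "network \<Rightarrow> nat \<Rightarrow> nat set" where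
  "neighbors S i = {j. (j, i) \<in> arcs S}"

definition precedents :: "network \<Rightarrow> nat \<Rightarrow> nat set" where
  "precedents S i = {j. (j, i) \<in> (arcs S)\<^sup>*}"

definition len_x :: "network \<Rightarrow> nat \<Rightarrow> nat" where
  "len_x S i = (horizon S + 1) * dim_x S i"

definition len_u :: "network \<Rightarrow> nat \<Rightarrow> nat" where
  "len_u S i = horizon S * dim_u S i"

definition len_xi :: "network \<Rightarrow> nat \<Rightarrow> nat" where
  "len_xi S i = horizon S * dim_xi S i"

definition valid_network :: "network \<Rightarrow> bool" where
  "valid_network S \<longleftrightarrow>
     arcs S \<subseteq> agents S \<times> agents S \<and>
     norm_p S \<in> {1, 2, \<infinity>} \<and>
     (\<forall>i\<in>agents S.
        x_init S i \<in> carrier_vec (dim_x S i) \<and>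
        (\<forall>t\<in>time_steps S.
           mat_A S i t \<in> carrier_mat (dim_x S i) (dim_x S i) \<and>
           mat_B S i t \<in> carrier_mat (dim_x S i) (\<Sum>j\<in>neighbors S i. dim_x S j) \<and>
           mat_D S i t \<in> carrier_mat (dim_x S i) (dim_u S i) \<and>
           mat_E S i t \<in> carrier_mat (dim_x S i) (dim_xi S i) \<and>
           full_column_rank (mat_A S i t) \<and> full_column_rank (mat_B S i t) \<and>
           full_column_rank (mat_D S i t) \<and> full_column_rank (mat_E S i t)) \<and>
        mat_Hx S i \<in> carrier_mat (dim_vec (vec_h S i)) (len_x S i) \<and>
        mat_Hu S i \<in> carrier_mat (dim_vec (vec_h S i)) (len_u S i) \<and>
        dim_col (mat_Q S i) = dim_x S i \<and>
        dim_col (mat_R S i) = dim_u S i \<and>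
        Xi S i \<noteq> {} \<and> compactin (vec_topology (len_xi S i)) (Xi S i) \<and>
        polyhedron_vec (len_xi S i) (Xi S i))"

text \<open>\<^term>\<open>dynamics S i x z u \<xi>\<close> is $x = f_i(z_{\mathcal{N}_i}, u, \xi)$; neighbors are
  concatenated in increasing order.\<close>

definition dynamics ::
  "network \<Rightarrow> nat \<Rightarrow> real vec \<Rightarrow> (nat \<Rightarrow> real vec) \<Rightarrow> real vec \<Rightarrow> real vec \<Rightarrow> bool" where
  "dynamics S i x z u \<xi> \<longleftrightarrow>
     block (dim_x S i) x 1 = x_init S i \<and>
     (\<forall>t\<in>time_steps S.
        block (dim_x S i) x (t + 1) =
          mat_A S i t *\<^sub>v block (dim_x S i) x t
          + mat_B S i t *\<^sub>v concat_vec (map (\<lambda>j. block (dim_x S j) (z j) t)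
                                        (sorted_list_of_set (neighbors S i)))
          + mat_D S i t *\<^sub>v block (dim_u S i) u t
          + mat_E S i t *\<^sub>v block (dim_xi S i) \<xi> t)"

definition op_constraints :: "network \<Rightarrow> nat \<Rightarrow> (real vec \<times> real vec) set" where
  "op_constraints S i =
     {(x, u). x \<in> carrier_vec (len_x S i) \<and> u \<in> carrier_vec (len_u S i) \<and>
              mat_Hx S i *\<^sub>v x + mat_Hu S i *\<^sub>v u \<le> vec_h S i}"

definition agent_cost :: "network \<Rightarrow> nat \<Rightarrow> real vec \<Rightarrow> real vec \<Rightarrow> real" where
  "agent_cost S i x u =
     (\<Sum>t\<in>time_steps S. pnorm (norm_p S) (mat_Q S i *\<^sub>v block (dim_x S i) x t)
                 + pnorm (norm_p S) (mat_R S i *\<^sub>v block (dim_u S i) u t))"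


section \<open>Partially nested information exchange\<close>

type_synonym pn_policy = "nat \<Rightarrow> (nat \<Rightarrow> real vec list) \<Rightarrow> real vec"

definition pn_policies :: "network \<Rightarrow> nat \<Rightarrow> pn_policy set" where
  "pn_policies S i =
     {\<Phi>. \<forall>t\<in>time_steps S. \<Phi> t \<in> (\<Pi>\<^sub>E j\<in>precedents S i. histories (dim_xi S j) (t - 1))
                              \<rightarrow> carrier_vec (dim_u S i)}"

definition pn_input ::
  "network \<Rightarrow> nat \<Rightarrow> pn_policy \<Rightarrow> (nat \<Rightarrow> real vec) \<Rightarrow> nat \<Rightarrow> real vec" where
  "pn_input S i \<Phi> \<xi> t = \<Phi> t (\<lambda>j\<in>precedents S i. history (dim_xi S j) (\<xi> j) (t - 1))"

text \<open>Joint trajectories of a set \<open>\<A>\<close> of agents that is closed under neighbors, e.g.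
  \<^term>\<open>precedents S i\<close>. The equations are explicit in time, so for well-typed policies and
  disturbances they have exactly one solution.\<close>

definition pn_response ::
  "network \<Rightarrow> nat set \<Rightarrow> (nat \<Rightarrow> pn_policy) \<Rightarrow> (nat \<Rightarrow> real vec)
     \<Rightarrow> (nat \<Rightarrow> real vec) \<Rightarrow> (nat \<Rightarrow> real vec) \<Rightarrow> bool" where
  "pn_response S \<A> \<Phi> \<xi> x u \<longleftrightarrow>
     x \<in> (\<Pi>\<^sub>E i\<in>\<A>. carrier_vec (len_x S i)) \<and>
     u \<in> (\<Pi>\<^sub>E i\<in>\<A>. carrier_vec (len_u S i)) \<and>
     (\<forall>i\<in>\<A>. (\<forall>t\<in>time_steps S. block (dim_u S i) (u i) t = pn_input S i (\<Phi> i) \<xi> t) \<and>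
            dynamics S i (x i) x (u i) (\<xi> i))"

definition pn_feasible :: "network \<Rightarrow> (nat \<Rightarrow> pn_policy) set" where
  "pn_feasible S =
     {\<Phi>. \<forall>i\<in>agents S. \<Phi> i \<in> pn_policies S i \<and>
          (\<forall>\<xi>\<in>\<Pi>\<^sub>E j\<in>precedents S i. Xi S j. \<forall>x u.
             pn_response S (precedents S i) \<Phi> \<xi> x u \<longrightarrow> (x i, u i) \<in> op_constraints S i)}"

definition pn_objective :: "network \<Rightarrow> (nat \<Rightarrow> pn_policy) \<Rightarrow> ereal" where
  "pn_objective S \<Phi> =
     (\<Sum>i\<in>agents S. Sup {ereal (agent_cost S i (x i) (u i)) | \<xi> x u.
        \<xi> \<in> (\<Pi>\<^sub>E j\<in>precedents S i. Xi S j) \<and> pn_response S (precedents S i) \<Phi> \<xi> x u})"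

definition pn_value :: "network \<Rightarrow> ereal" where
  "pn_value S = (INF \<Phi>\<in>pn_feasible S. pn_objective S \<Phi>)"


section \<open>Local information exchange\<close>

type_synonym local_policy =
  "nat \<Rightarrow> real vec list \<Rightarrow> (nat \<Rightarrow> real vec list) \<Rightarrow> real vec"

definition local_policies :: "network \<Rightarrow> nat \<Rightarrow> local_policy set" where
  "local_policies S i =
     {\<Psi>. \<forall>t\<in>time_steps S. \<Psi> t \<in> histories (dim_xi S i) (t - 1) \<rightarrow>
                              (\<Pi>\<^sub>E j\<in>neighbors S i. histories (dim_x S j) t) \<rightarrow>
                              carrier_vec (dim_u S i)}"

definition local_input ::
  "network \<Rightarrow> nat \<Rightarrow> local_policy \<Rightarrow> real vec \<Rightarrow> (nat \<Rightarrow> real vec) \<Rightarrow> nat \<Rightarrow> real vec" where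
  "local_input S i \<Psi> \<xi> z t =
     \<Psi> t (history (dim_xi S i) \<xi> (t - 1)) (\<lambda>j\<in>neighbors S i. history (dim_x S j) (z j) t)"

definition local_response ::
  "network \<Rightarrow> nat \<Rightarrow> local_policy \<Rightarrow> real vec \<Rightarrow> (nat \<Rightarrow> real vec) \<Rightarrow> real vec \<Rightarrow> real vec \<Rightarrow> bool"
where
  "local_response S i \<Psi> \<xi> \<zeta> x u \<longleftrightarrow>
     x \<in> carrier_vec (len_x S i) \<and> u \<in> carrier_vec (len_u S i) \<and>
     (\<forall>t\<in>time_steps S. block (dim_u S i) u t = local_input S i \<Psi> \<xi> \<zeta> t) \<and>
     dynamics S i x \<zeta> u \<xi>"

definition forecast_sets :: "nat \<Rightarrow> real vec set set" where
  "forecast_sets n = {X. X \<noteq> {} \<and> compactin (vec_topology n) X}"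

definition local_feasible :: "network \<Rightarrow> ((nat \<Rightarrow> local_policy) \<times> (nat \<Rightarrow> real vec set)) set" where
  "local_feasible S =
     {(\<Psi>, X). \<forall>i\<in>agents S. \<Psi> i \<in> local_policies S i \<and> X i \<in> forecast_sets (len_x S i) \<and>
          (\<forall>\<xi>\<in>Xi S i. \<forall>\<zeta>\<in>\<Pi>\<^sub>E j\<in>neighbors S i. X j. \<forall>x u.
             local_response S i (\<Psi> i) \<xi> \<zeta> x u \<longrightarrow> (x, u) \<in> op_constraints S i \<and> x \<in> X i)}"

definition local_objective ::
  "network \<Rightarrow> (nat \<Rightarrow> local_policy) \<times> (nat \<Rightarrow> real vec set) \<Rightarrow> ereal" where
  "local_objective S = (\<lambda>(\<Psi>, X).
     \<Sum>i\<in>agents S. Sup {ereal (agent_cost S i x u) | \<xi> \<zeta> x u.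
        \<xi> \<in> Xi S i \<and> \<zeta> \<in> (\<Pi>\<^sub>E j\<in>neighbors S i. X j) \<and> local_response S i (\<Psi> i) \<xi> \<zeta> x u})"

definition local_value :: "network \<Rightarrow> ereal" where
  "local_value S = (INF s\<in>local_feasible S. local_objective S s)"

text \<open>Trajectories of the whole network when every agent evaluates its local policy at the actual
  neighbor states instead of beliefs.\<close>

definition closed_loop ::
  "network \<Rightarrow> (nat \<Rightarrow> local_policy) \<Rightarrow> (nat \<Rightarrow> real vec)
     \<Rightarrow> (nat \<Rightarrow> real vec) \<Rightarrow> (nat \<Rightarrow> real vec) \<Rightarrow> bool" where
  "closed_loop S \<Psi> \<xi> x u \<longleftrightarrow>
     x \<in> (\<Pi>\<^sub>E i\<in>agents S. carrier_vec (len_x S i)) \<and>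
     u \<in> (\<Pi>\<^sub>E i\<in>agents S. carrier_vec (len_u S i)) \<and>
     (\<forall>i\<in>agents S. (\<forall>t\<in>time_steps S. block (dim_u S i) (u i) t = local_input S i (\<Psi> i) (\<xi> i) x t) \<and>
                   dynamics S i (x i) x (u i) (\<xi> i))"

end

theory Submission
  imports Defs
begin

text \<open>
  A local solution (\<open>\<Psi>\<close>, \<open>X\<close>) is turned into partially nested policies by simulation. The network
  equations are explicit in time, so an agent that knows the past disturbances of all its precedents
  can recompute the past and current states of its neighbors, feed them to its local policy, and
  obtain its input. This is the policy \<open>nested_policy\<close>; it is well defined because the simulated
  input of agent \<open>i\<close> at time \<open>t\<close> depends on the disturbances of the precedents of \<open>i\<close> before
  \<open>t\<close> only (\<open>sim_input_cong\<close>), and it reproduces the closed loop (\<open>history_eq_sim_states\<close>).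
  The same simulation shows that the closed loop has exactly one trajectory: it constructs one, and
  every other one must agree with it.

  The heart of the matter is that actual states lie in the forecast sets
  (\<open>states_in_forecasts\<close>). The graph may contain cycles, so one cannot go from agent to agent:
  ``the neighbors respect their forecasts, hence so do I'' would be circular. Instead one goes
  forward in time. Suppose that up to time \<open>t\<close> the state trajectory of every agent coincides with
  some member of its forecast set. Take these members as beliefs. The local responses to these
  beliefs belong to the forecast sets by local feasibility, and by strict causality of the state
  equation they coincide with the actual trajectories up to time \<open>t + 1\<close>. At the final time a
  member of the forecast set coincides with the whole actual trajectory.

  Hence every partially nested response is, agent by agent, a local response to beliefs that lie in
  the forecast sets. Operational constraints are inherited, and each worst-case cost of the
  partially nested problem is a supremum over a smaller set of trajectories.
\<close>

section \<open>Stacked trajectories\<close>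

definition stack_blocks :: "nat \<Rightarrow> nat \<Rightarrow> (nat \<Rightarrow> real vec) \<Rightarrow> real vec" where
  "stack_blocks n T g = vec (T * n) (\<lambda>k. g (k div n + 1) $ (k mod n))"

lemma block_index_less:
  assumes "t \<in> {1..T}" and "k < n"
  shows "(t - 1) * n + k < T * (n::nat)"
proof -
  have "(t - 1) * n + k < (t - 1) * n + n" using assms by simp
  also have "\<dots> = t * n" using assms by (cases t) auto
  also have "\<dots> \<le> T * n" using assms by simp
  finally show ?thesis .
qed

lemma block_carrier [simp]: "block n v t \<in> carrier_vec n"
  by (simp add: block_def)

lemma stack_blocks_carrier [simp]: "stack_blocks n T g \<in> carrier_vec (T * n)"
  by (simp add: stack_blocks_def)

lemma block_stack_blocks:
  assumes "t \<in> {1..T}" and "g t \<in> carrier_vec n"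
  shows "block n (stack_blocks n T g) t = g t"
proof (rule eq_vecI)
  fix k assume "k < dim_vec (g t)"
  then have k: "k < n" using assms by simp
  then show "block n (stack_blocks n T g) t $ k = g t $ k"
    using assms(1) block_index_less[OF assms(1) k] by (simp add: block_def stack_blocks_def)
qed (use assms in \<open>simp add: block_def\<close>)

lemma vec_eq_if_blocks_eq:
  assumes "v \<in> carrier_vec (T * n)" and "w \<in> carrier_vec (T * n)"
    and blocks: "\<And>t. t \<in> {1..T} \<Longrightarrow> block n v t = block n w t"
  shows "v = w"
proof (rule eq_vecI)
  fix k assume "k < dim_vec w"
  then have k: "k < T * n" using assms by simp
  then have n: "n > 0" by (cases n) auto
  have "k div n + 1 \<in> {1..T}" using k by (simp add: less_mult_imp_div_less Suc_leI)
  from arg_cong[OF blocks[OF this], of "\<lambda>b. b $ (k mod n)"]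
  show "v $ k = w $ k" using n by (simp add: block_def)
qed (use assms in simp)

lemma history_eq_iff:
  "history n v t = history n w t \<longleftrightarrow> (\<forall>s\<in>{1..t}. block n v s = block n w s)"
  by (auto simp: history_def)

section \<open>The state equation\<close>

definition state_step ::
  "network \<Rightarrow> nat \<Rightarrow> nat \<Rightarrow> real vec \<Rightarrow> (nat \<Rightarrow> real vec) \<Rightarrow> real vec \<Rightarrow> real vec \<Rightarrow> real vec" where
  "state_step S i t x z u v =
     mat_A S i t *\<^sub>v x
     + mat_B S i t *\<^sub>v concat_vec (map z (sorted_list_of_set (neighbors S i)))
     + mat_D S i t *\<^sub>v u + mat_E S i t *\<^sub>v v"

lemma dynamics_iff_state_step:
  "dynamics S i x z u \<xi> \<longleftrightarrow>
     block (dim_x S i) x 1 = x_init S i \<and>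
     (\<forall>t\<in>time_steps S. block (dim_x S i) x (t + 1) =
        state_step S i t (block (dim_x S i) x t) (\<lambda>j. block (dim_x S j) (z j) t)
          (block (dim_u S i) u t) (block (dim_xi S i) \<xi> t))"
  by (simp add: dynamics_def state_step_def)

lemma state_step_cong:
  assumes "x = x'" and "\<And>j. j \<in> neighbors S i \<Longrightarrow> z j = z' j" and "u = u'" and "v = v'"
  shows "state_step S i t x z u v = state_step S i t x' z' u' v'"
proof -
  have maps: "map z (sorted_list_of_set (neighbors S i)) =
      map z' (sorted_list_of_set (neighbors S i))"
  proof (cases "finite (neighbors S i)")
    case True
    then show ?thesis using assms(2) by simp
  next
    case False
    then show ?thesis by simp
  qed
  show ?thesis unfolding state_step_def maps assms(1,3,4) ..
qed

lemma state_step_carrier: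
  assumes "valid_network S" and "i \<in> agents S" and "t \<in> time_steps S"
  shows "state_step S i t x z u v \<in> carrier_vec (dim_x S i)"
proof -
  have "mat_E S i t \<in> carrier_mat (dim_x S i) (dim_xi S i)"
    using assms by (simp add: valid_network_def)
  then show ?thesis
    by (simp only: state_step_def carrier_vec_def mem_Collect_eq index_add_vec(2)
        dim_mult_mat_vec carrier_matD(1))
qed

lemma x_init_carrier:
  assumes "valid_network S" and "i \<in> agents S"
  shows "x_init S i \<in> carrier_vec (dim_x S i)"
  using assms by (simp add: valid_network_def)

lemma neighbors_subset_agents:
  assumes "valid_network S"
  shows "neighbors S i \<subseteq> agents S"
  using assms by (auto simp: valid_network_def neighbors_def)

lemma precedents_refl [simp]: "i \<in> precedents S i"
  by (simp add: precedents_def)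

lemma neighbors_subset_precedents:
  assumes "j \<in> precedents S i"
  shows "neighbors S j \<subseteq> precedents S i"
proof
  fix k assume "k \<in> neighbors S j"
  then have "(k, j) \<in> arcs S" by (simp add: neighbors_def)
  moreover have "(j, i) \<in> (arcs S)\<^sup>*" using assms by (simp add: precedents_def)
  ultimately have "(k, i) \<in> (arcs S)\<^sup>*" by (rule converse_rtrancl_into_rtrancl)
  then show "k \<in> precedents S i" by (simp add: precedents_def)
qed

lemma precedents_neighbor_subset:
  assumes "j \<in> neighbors S i"
  shows "precedents S j \<subseteq> precedents S i"
proof
  fix k assume "k \<in> precedents S j"
  then have "(k, j) \<in> (arcs S)\<^sup>*" by (simp add: precedents_def)
  moreover have "(j, i) \<in> arcs S" using assms by (simp add: neighbors_def)
  ultimately have "(k, i) \<in> (arcs S)\<^sup>*" by (rule rtrancl_into_rtrancl)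
  then show "k \<in> precedents S i" by (simp add: precedents_def)
qed

lemma precedents_subset_agents:
  assumes "valid_network S" and "i \<in> agents S"
  shows "precedents S i \<subseteq> agents S"
proof
  fix j assume "j \<in> precedents S i"
  then have "(j, i) \<in> (arcs S)\<^sup>*" by (simp add: precedents_def)
  then show "j \<in> agents S"
    by (cases rule: converse_rtranclE) (use assms in \<open>auto simp: valid_network_def\<close>)
qed

lemma dynamics_stack_blocks:
  assumes S: "valid_network S" "i \<in> agents S"
    and init: "g 1 = x_init S i"
    and step: "\<And>t. t \<in> time_steps S \<Longrightarrow>
      g (t + 1) = state_step S i t (g t) (\<lambda>j. block (dim_x S j) (z j) t)
        (block (dim_u S i) u t) (block (dim_xi S i) \<xi> t)"
  shows "dynamics S i (stack_blocks (dim_x S i) (horizon S + 1) g) z u \<xi>"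
proof -
  have g: "g t \<in> carrier_vec (dim_x S i)" if "t \<in> {1..horizon S + 1}" for t
  proof (cases "t = 1")
    case True
    then show ?thesis using init x_init_carrier[OF S] by simp
  next
    case False
    then have "t - 1 \<in> time_steps S" and "t - 1 + 1 = t" using that by (auto simp: time_steps_def)
    then show ?thesis using step[of "t - 1"] state_step_carrier[OF S] by metis
  qed
  have blocks: "block (dim_x S i) (stack_blocks (dim_x S i) (horizon S + 1) g) t = g t"
    if "t \<in> {1..horizon S + 1}" for t
    using that g[OF that] by (rule block_stack_blocks)
  show ?thesis
    unfolding dynamics_iff_state_step
  proof (intro conjI ballI)
    show "block (dim_x S i) (stack_blocks (dim_x S i) (horizon S + 1) g) 1 = x_init S i"
      using blocks[of 1] init by simp
    fix t assume t: "t \<in> time_steps S"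
    have "t \<in> {1..horizon S + 1}" "t + 1 \<in> {1..horizon S + 1}"
      using t by (auto simp: time_steps_def)
    from this[THEN blocks]
    show "block (dim_x S i) (stack_blocks (dim_x S i) (horizon S + 1) g) (t + 1) =
        state_step S i t (block (dim_x S i) (stack_blocks (dim_x S i) (horizon S + 1) g) t)
          (\<lambda>j. block (dim_x S j) (z j) t) (block (dim_u S i) u t) (block (dim_xi S i) \<xi> t)"
      by (simp only: step[OF t])
  qed
qed

lemma dynamics_solvable:
  assumes "valid_network S" and "i \<in> agents S"
  shows "\<exists>x\<in>carrier_vec (len_x S i). dynamics S i x z u \<xi>"
proof -
  define g where "g = rec_nat (x_init S i) (\<lambda>t y. state_step S i (Suc t) y
    (\<lambda>j. block (dim_x S j) (z j) (Suc t)) (block (dim_u S i) u (Suc t))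
    (block (dim_xi S i) \<xi> (Suc t)))"
  have "dynamics S i (stack_blocks (dim_x S i) (horizon S + 1) (\<lambda>t. g (t - 1))) z u \<xi>"
  proof (rule dynamics_stack_blocks[OF assms])
    fix t assume "t \<in> time_steps S"
    then obtain r where "t = Suc r" by (cases t) (auto simp: time_steps_def)
    then show "g (t + 1 - 1) = state_step S i t (g (t - 1)) (\<lambda>j. block (dim_x S j) (z j) t)
        (block (dim_u S i) u t) (block (dim_xi S i) \<xi> t)"
      by (simp add: g_def)
  qed (simp add: g_def)
  then show ?thesis
    unfolding len_x_def using stack_blocks_carrier by blast
qed

section \<open>Simulation of the closed loop\<close>

definition feedback_input ::
  "network \<Rightarrow> (nat \<Rightarrow> local_policy) \<Rightarrow> (nat \<Rightarrow> nat \<Rightarrow> real vec) \<Rightarrow> (nat \<Rightarrow> real vec list)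
     \<Rightarrow> nat \<Rightarrow> nat \<Rightarrow> real vec" where
  "feedback_input S \<Psi> w H i t = \<Psi> i t (map (w i) [1..<t]) (\<lambda>j\<in>neighbors S i. H j)"

text \<open>The disturbances enter as arbitrary functions \<open>w\<close> of agent and time, so that the same
  recursion can be run on full trajectories and on the truncated histories that a partially nested
  policy observes. The list after \<open>t\<close> steps holds the states at times 1 to \<open>t + 1\<close>; the input at
  time \<open>t\<close>, which reads \<open>t\<close> states of each neighbor, is therefore computed from the lists after
  \<open>t - 1\<close> steps.\<close>

primrec sim_states ::
  "network \<Rightarrow> (nat \<Rightarrow> local_policy) \<Rightarrow> (nat \<Rightarrow> nat \<Rightarrow> real vec) \<Rightarrow> nat \<Rightarrow> nat \<Rightarrow> real vec list" where
  "sim_states S \<Psi> w 0 = (\<lambda>i. [x_init S i])"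
| "sim_states S \<Psi> w (Suc t) = (\<lambda>i. sim_states S \<Psi> w t i @
     [state_step S i (Suc t) (last (sim_states S \<Psi> w t i)) (\<lambda>j. last (sim_states S \<Psi> w t j))
        (feedback_input S \<Psi> w (sim_states S \<Psi> w t) i (Suc t)) (w i (Suc t))])"

definition sim_input ::
  "network \<Rightarrow> (nat \<Rightarrow> local_policy) \<Rightarrow> (nat \<Rightarrow> nat \<Rightarrow> real vec) \<Rightarrow> nat \<Rightarrow> nat \<Rightarrow> real vec" where
  "sim_input S \<Psi> w i t = feedback_input S \<Psi> w (sim_states S \<Psi> w (t - 1)) i t"

lemma feedback_input_cong:
  assumes "\<And>s. s \<in> {1..<t} \<Longrightarrow> w i s = w' i s" and "\<And>j. j \<in> neighbors S i \<Longrightarrow> H j = H' j"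
  shows "feedback_input S \<Psi> w H i t = feedback_input S \<Psi> w' H' i t"
proof -
  have past: "map (w i) [1..<t] = map (w' i) [1..<t]" using assms(1) by auto
  have nbrs: "(\<lambda>j\<in>neighbors S i. H j) = (\<lambda>j\<in>neighbors S i. H' j)"
    using assms(2) by (rule restrict_ext)
  show ?thesis unfolding feedback_input_def past nbrs ..
qed

lemma sim_states_cong:
  assumes "\<And>j s. j \<in> precedents S i \<Longrightarrow> s \<in> {1..t} \<Longrightarrow> w j s = w' j s"
  shows "sim_states S \<Psi> w t i = sim_states S \<Psi> w' t i"
  using assms
proof (induction t arbitrary: i)
  case (Suc t)
  have own: "sim_states S \<Psi> w t i = sim_states S \<Psi> w' t i"
    by (rule Suc.IH) (use Suc.prems in auto)
  have nbr: "sim_states S \<Psi> w t j = sim_states S \<Psi> w' t j" if "j \<in> neighbors S i" for j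
    by (rule Suc.IH) (use Suc.prems precedents_neighbor_subset[OF that] in auto)
  have "w i s = w' i s" if "s \<in> {1..Suc t}" for s
    using Suc.prems that precedents_refl by blast
  then show ?case
    using own nbr by (auto intro!: state_step_cong feedback_input_cong)
qed simp

text \<open>Strict causality: the states before time \<open>t + 1\<close> are driven by the disturbances before \<open>t\<close>,
  and influence travels along arcs only.\<close>

lemma sim_input_cong:
  assumes "\<And>j s. j \<in> precedents S i \<Longrightarrow> s \<in> {1..<t} \<Longrightarrow> w j s = w' j s"
  shows "sim_input S \<Psi> w i t = sim_input S \<Psi> w' i t"
  unfolding sim_input_def
proof (rule feedback_input_cong)
  show "w i s = w' i s" if "s \<in> {1..<t}" for s using assms that by simp
  show "sim_states S \<Psi> w (t - 1) j = sim_states S \<Psi> w' (t - 1) j" if "j \<in> neighbors S i" for j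
    by (rule sim_states_cong) (use assms precedents_neighbor_subset[OF that] in auto)
qed

lemma sim_states_eq_map_last:
  "sim_states S \<Psi> w t i = map (\<lambda>s. last (sim_states S \<Psi> w (s - 1) i)) [1..<Suc (Suc t)]"
    (is "_ = map ?f _")
proof (induction t)
  case (Suc t)
  have "sim_states S \<Psi> w (Suc t) i = sim_states S \<Psi> w t i @ [?f (Suc (Suc t))]" by simp
  also have "\<dots> = map ?f [1..<Suc (Suc t)] @ [?f (Suc (Suc t))]"
    \<comment> \<open>A single rewrite: the right-hand side of the hypothesis contains its left-hand side.\<close>
    by (subst Suc.IH) (rule refl)
  also have "\<dots> = map ?f [1..<Suc (Suc (Suc t))]" by simp
  finally show ?case .
qed simp

lemma sim_states_histories:
  assumes "valid_network S" and "i \<in> agents S" and "t \<le> horizon S"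
  shows "sim_states S \<Psi> w t i \<in> histories (dim_x S i) (t + 1)"
  using assms(3)
proof (induction t)
  case 0
  then show ?case using x_init_carrier[OF assms(1,2)] by (simp add: histories_def)
next
  case (Suc t)
  then show ?case
    using state_step_carrier[OF assms(1,2), of "Suc t"] by (simp add: histories_def time_steps_def)
qed

lemma sim_input_carrier:
  assumes S: "valid_network S" "i \<in> agents S" and \<Psi>: "\<Psi> i \<in> local_policies S i"
    and t: "t \<in> time_steps S"
    and w: "\<And>s. s \<in> {1..<t} \<Longrightarrow> w i s \<in> carrier_vec (dim_xi S i)"
  shows "sim_input S \<Psi> w i t \<in> carrier_vec (dim_u S i)"
proof -
  have "map (w i) [1..<t] \<in> histories (dim_xi S i) (t - 1)"
    using w by (auto simp: histories_def)
  moreover have "(\<lambda>j\<in>neighbors S i. sim_states S \<Psi> w (t - 1) j)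
      \<in> (\<Pi>\<^sub>E j\<in>neighbors S i. histories (dim_x S j) t)"
  proof (rule restrict_PiE_iff[THEN iffD2], rule ballI)
    fix j assume "j \<in> neighbors S i"
    then have "j \<in> agents S" using neighbors_subset_agents[OF S(1)] by blast
    moreover have "t - 1 \<le> horizon S" and "t - 1 + 1 = t" using t by (auto simp: time_steps_def)
    ultimately show "sim_states S \<Psi> w (t - 1) j \<in> histories (dim_x S j) t"
      using sim_states_histories[OF S(1), of j "t - 1" \<Psi> w] by simp
  qed
  moreover have "\<Psi> i t \<in> histories (dim_xi S i) (t - 1) \<rightarrow>
      (\<Pi>\<^sub>E j\<in>neighbors S i. histories (dim_x S j) t) \<rightarrow> carrier_vec (dim_u S i)"
    using \<Psi> t by (simp add: local_policies_def)
  ultimately show ?thesis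
    unfolding sim_input_def feedback_input_def by (blast dest: funcset_mem)
qed

definition disturbance_blocks :: "network \<Rightarrow> (nat \<Rightarrow> real vec) \<Rightarrow> nat \<Rightarrow> nat \<Rightarrow> real vec" where
  "disturbance_blocks S \<xi> j s = block (dim_xi S j) (\<xi> j) s"

lemma local_input_eq_feedback_input:
  assumes "t \<ge> 1"
  shows "local_input S i (\<Psi> i) (\<xi> i) z t =
    feedback_input S \<Psi> (disturbance_blocks S \<xi>) (\<lambda>j. history (dim_x S j) (z j) t) i t"
  using assms by (simp add: local_input_def feedback_input_def history_def disturbance_blocks_def
      comp_def del: upt_Suc cong: map_cong)

text \<open>The hypothesis on the inputs is conditional so that it covers both ways of closing the loop:
  by feedback from the actual neighbor states, and by partially nested policies, which apply the
  simulated input outright. The set \<open>\<A>\<close> may be all agents or the precedents of one agent.\<close>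

lemma history_eq_sim_states:
  fixes S \<Psi> \<xi>
  defines "w \<equiv> disturbance_blocks S \<xi>"
  assumes closed: "\<And>i. i \<in> \<A> \<Longrightarrow> neighbors S i \<subseteq> \<A>"
    and dyn: "\<And>i. i \<in> \<A> \<Longrightarrow> dynamics S i (x i) x (u i) (\<xi> i)"
    and input: "\<And>i t. i \<in> \<A> \<Longrightarrow> t \<in> time_steps S \<Longrightarrow>
      (\<And>j. j \<in> neighbors S i \<Longrightarrow> history (dim_x S j) (x j) t = sim_states S \<Psi> w (t - 1) j) \<Longrightarrow>
      block (dim_u S i) (u i) t = sim_input S \<Psi> w i t"
    and "i \<in> \<A>" and "t \<le> horizon S"
  shows "history (dim_x S i) (x i) (t + 1) = sim_states S \<Psi> w t i"
  using assms(5,6)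
proof (induction t arbitrary: i)
  case 0
  then show ?case using dyn by (simp add: dynamics_def history_def)
next
  case (Suc t)
  have T: "Suc t \<in> time_steps S" using Suc.prems by (simp add: time_steps_def)
  have hist: "history (dim_x S j) (x j) (Suc t) = sim_states S \<Psi> w t j" if "j \<in> \<A>" for j
    using Suc.IH[OF that] Suc.prems by simp
  have block_last: "block (dim_x S j) (x j) (Suc t) = last (sim_states S \<Psi> w t j)"
    if "j \<in> \<A>" for j
    using hist[OF that, symmetric] by (simp add: history_def)
  have u: "block (dim_u S i) (u i) (Suc t) = sim_input S \<Psi> w i (Suc t)"
    by (rule input[OF Suc.prems(1) T]) (use hist closed[OF Suc.prems(1)] in auto)
  have "block (dim_x S i) (x i) (Suc t + 1) =
      state_step S i (Suc t) (block (dim_x S i) (x i) (Suc t))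
        (\<lambda>j. block (dim_x S j) (x j) (Suc t)) (block (dim_u S i) (u i) (Suc t))
        (block (dim_xi S i) (\<xi> i) (Suc t))"
    using dyn[OF Suc.prems(1)] T unfolding dynamics_iff_state_step by blast
  also have "\<dots> = state_step S i (Suc t) (last (sim_states S \<Psi> w t i))
      (\<lambda>j. last (sim_states S \<Psi> w t j))
      (feedback_input S \<Psi> w (sim_states S \<Psi> w t) i (Suc t)) (w i (Suc t))"
    using block_last closed[OF Suc.prems(1)] Suc.prems(1) u
    by (intro state_step_cong) (auto simp: w_def disturbance_blocks_def sim_input_def)
  finally show ?case
    using hist[OF Suc.prems(1)] by (simp add: history_def)
qed

lemma closed_loop_history:
  assumes "valid_network S" and loop: "closed_loop S \<Psi> \<xi> x u"
    and "i \<in> agents S" and "t \<le> horizon S"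
  shows "history (dim_x S i) (x i) (t + 1) = sim_states S \<Psi> (disturbance_blocks S \<xi>) t i"
proof (rule history_eq_sim_states[where \<A> = "agents S" and u = u])
  fix i t
  assume i: "i \<in> agents S" and t: "t \<in> time_steps S"
    and hist: "\<And>j. j \<in> neighbors S i \<Longrightarrow>
      history (dim_x S j) (x j) t = sim_states S \<Psi> (disturbance_blocks S \<xi>) (t - 1) j"
  have "block (dim_u S i) (u i) t = local_input S i (\<Psi> i) (\<xi> i) x t"
    using loop i t by (simp add: closed_loop_def)
  also have "\<dots> = sim_input S \<Psi> (disturbance_blocks S \<xi>) i t"
    using t hist by (simp add: local_input_eq_feedback_input sim_input_def time_steps_def
        cong: feedback_input_cong)
  finally show "block (dim_u S i) (u i) t = sim_input S \<Psi> (disturbance_blocks S \<xi>) i t" .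
next
  show "neighbors S j \<subseteq> agents S" for j using assms(1) by (rule neighbors_subset_agents)
  show "dynamics S j (x j) x (u j) (\<xi> j)" if "j \<in> agents S" for j
    using loop that unfolding closed_loop_def by blast
qed (fact assms(3,4))+

lemma closed_loop_input:
  assumes "valid_network S" and loop: "closed_loop S \<Psi> \<xi> x u"
    and i: "i \<in> agents S" and t: "t \<in> time_steps S"
  shows "block (dim_u S i) (u i) t = sim_input S \<Psi> (disturbance_blocks S \<xi>) i t"
proof -
  have "history (dim_x S j) (x j) t = sim_states S \<Psi> (disturbance_blocks S \<xi>) (t - 1) j"
    if j: "j \<in> neighbors S i" for j
  proof -
    have "j \<in> agents S" using j neighbors_subset_agents[OF assms(1)] by blast
    moreover have "t - 1 \<le> horizon S" and "t - 1 + 1 = t" using t by (auto simp: time_steps_def)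
    ultimately show ?thesis
      using closed_loop_history[OF assms(1) loop, of j "t - 1"] by simp
  qed
  then have "local_input S i (\<Psi> i) (\<xi> i) x t = sim_input S \<Psi> (disturbance_blocks S \<xi>) i t"
    using t by (simp add: local_input_eq_feedback_input sim_input_def time_steps_def
        cong: feedback_input_cong)
  then show ?thesis using loop i t by (simp add: closed_loop_def)
qed

lemma closed_loop_unique:
  assumes "valid_network S" and xu: "closed_loop S \<Psi> \<xi> x u" and xu': "closed_loop S \<Psi> \<xi> x' u'"
  shows "x = x' \<and> u = u'"
proof
  have x: "x \<in> (\<Pi>\<^sub>E i\<in>agents S. carrier_vec ((horizon S + 1) * dim_x S i))"
      "x' \<in> (\<Pi>\<^sub>E i\<in>agents S. carrier_vec ((horizon S + 1) * dim_x S i))"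
    and u: "u \<in> (\<Pi>\<^sub>E i\<in>agents S. carrier_vec (horizon S * dim_u S i))"
      "u' \<in> (\<Pi>\<^sub>E i\<in>agents S. carrier_vec (horizon S * dim_u S i))"
    using xu xu' unfolding closed_loop_def len_x_def len_u_def by blast+
  show "x = x'"
  proof (rule PiE_ext[OF x])
    fix i assume i: "i \<in> agents S"
    have "history (dim_x S i) (x i) (horizon S + 1) = history (dim_x S i) (x' i) (horizon S + 1)"
      using closed_loop_history[OF assms(1) xu i] closed_loop_history[OF assms(1) xu' i] by simp
    then have "block (dim_x S i) (x i) t = block (dim_x S i) (x' i) t"
      if "t \<in> {1..horizon S + 1}" for t
      unfolding history_eq_iff using that by blast
    then show "x i = x' i"
      by (rule vec_eq_if_blocks_eq[OF PiE_mem[OF x(1) i] PiE_mem[OF x(2) i]])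
  qed
  show "u = u'"
  proof (rule PiE_ext[OF u])
    fix i assume i: "i \<in> agents S"
    have "block (dim_u S i) (u i) t = block (dim_u S i) (u' i) t" if "t \<in> {1..horizon S}" for t
      using closed_loop_input[OF assms(1) xu i] closed_loop_input[OF assms(1) xu' i] that
      by (simp add: time_steps_def)
    then show "u i = u' i"
      by (rule vec_eq_if_blocks_eq[OF PiE_mem[OF u(1) i] PiE_mem[OF u(2) i]])
  qed
qed

lemma closed_loop_exists:
  assumes S: "valid_network S" and \<Psi>: "\<And>i. i \<in> agents S \<Longrightarrow> \<Psi> i \<in> local_policies S i"
  shows "\<exists>x u. closed_loop S \<Psi> \<xi> x u"
proof -
  let ?T = "horizon S"
  define w where "w = disturbance_blocks S \<xi>"
  define g where "g i t = last (sim_states S \<Psi> w (t - 1) i)" for i t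
  define x where "x = (\<lambda>i\<in>agents S. stack_blocks (dim_x S i) (?T + 1) (g i))"
  define u where "u = (\<lambda>i\<in>agents S. stack_blocks (dim_u S i) ?T (sim_input S \<Psi> w i))"
  have g: "g i t \<in> carrier_vec (dim_x S i)" if "i \<in> agents S" "t \<in> {1..?T + 1}" for i t
  proof -
    have "sim_states S \<Psi> w (t - 1) i \<in> histories (dim_x S i) (t - 1 + 1)"
      using that by (intro sim_states_histories[OF S]) auto
    then show ?thesis unfolding g_def histories_def
      by (metis (mono_tags, lifting) Suc_eq_plus1 last_in_set length_0_conv mem_Collect_eq
          nat.distinct(1) subset_code(1))
  qed
  have bx: "block (dim_x S i) (x i) t = g i t" if "i \<in> agents S" "t \<in> {1..?T + 1}" for i t
    using block_stack_blocks[of t "?T + 1" "g i", OF that(2) g[OF that]] that by (simp add: x_def)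
  have bu: "block (dim_u S i) (u i) t = sim_input S \<Psi> w i t"
    if i: "i \<in> agents S" and t: "t \<in> time_steps S" for i t
  proof -
    have "sim_input S \<Psi> w i t \<in> carrier_vec (dim_u S i)"
      by (rule sim_input_carrier[of S i \<Psi>, OF S i \<Psi>[OF i] t]) (simp add: w_def disturbance_blocks_def)
    then show ?thesis
      using block_stack_blocks[of t ?T "sim_input S \<Psi> w i"] i t by (simp add: u_def time_steps_def)
  qed
  have hist: "history (dim_x S i) (x i) t = sim_states S \<Psi> w (t - 1) i"
    if "i \<in> agents S" "t \<in> {1..?T + 1}" for i t
  proof -
    have "history (dim_x S i) (x i) t = map (g i) [1..<Suc t]"
      unfolding history_def using that bx by (intro map_cong) auto
    also have "\<dots> = sim_states S \<Psi> w (t - 1) i"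
      using that by (subst sim_states_eq_map_last) (auto simp: g_def)
    finally show ?thesis .
  qed
  have "closed_loop S \<Psi> \<xi> x u"
    unfolding closed_loop_def
  proof (intro conjI ballI)
    show "x \<in> (\<Pi>\<^sub>E i\<in>agents S. carrier_vec (len_x S i))"
      unfolding x_def len_x_def restrict_PiE_iff using stack_blocks_carrier by blast
    show "u \<in> (\<Pi>\<^sub>E i\<in>agents S. carrier_vec (len_u S i))"
      unfolding u_def len_u_def restrict_PiE_iff using stack_blocks_carrier by blast
  next
    fix i t assume i: "i \<in> agents S" and t: "t \<in> time_steps S"
    have "history (dim_x S j) (x j) t = sim_states S \<Psi> w (t - 1) j"
      if j: "j \<in> neighbors S i" for j
    proof -
      have "j \<in> agents S" using j neighbors_subset_agents[OF S] by blast
      moreover have "t \<in> {1..?T + 1}" using t by (auto simp: time_steps_def)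
      ultimately show ?thesis by (rule hist)
    qed
    then have "local_input S i (\<Psi> i) (\<xi> i) x t = sim_input S \<Psi> w i t"
      using t by (simp add: local_input_eq_feedback_input sim_input_def time_steps_def w_def
          cong: feedback_input_cong)
    then show "block (dim_u S i) (u i) t = local_input S i (\<Psi> i) (\<xi> i) x t"
      using bu[OF i t] by simp
  next
    fix i assume i: "i \<in> agents S"
    have "dynamics S i (stack_blocks (dim_x S i) (?T + 1) (g i)) x (u i) (\<xi> i)"
    proof (rule dynamics_stack_blocks[OF S i])
      fix t assume t: "t \<in> time_steps S"
      then obtain r where r: "t = Suc r" by (cases t) (auto simp: time_steps_def)
      have "g i (t + 1) = state_step S i t (g i t) (\<lambda>j. g j t)
          (sim_input S \<Psi> w i t) (w i t)"
        by (simp add: g_def r sim_input_def)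
      also have "\<dots> = state_step S i t (g i t) (\<lambda>j. block (dim_x S j) (x j) t)
          (block (dim_u S i) (u i) t) (block (dim_xi S i) (\<xi> i) t)"
      proof (rule state_step_cong)
        have "t \<in> {1..?T + 1}" using t by (auto simp: time_steps_def)
        then show "g j t = block (dim_x S j) (x j) t" if "j \<in> neighbors S i" for j
          using bx that neighbors_subset_agents[OF S, of i] by (metis subsetD)
      qed (simp_all add: bu[OF i t] w_def disturbance_blocks_def)
      finally show "g i (t + 1) = \<dots>" .
    qed (simp add: g_def)
    then show "dynamics S i (x i) x (u i) (\<xi> i)" using i by (simp add: x_def)
  qed
  then show ?thesis by blast
qed

section \<open>Actual states lie in the forecast sets\<close>

lemma local_response_cong:
  assumes "\<And>j. j \<in> neighbors S i \<Longrightarrow> z j = z' j"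
  shows "local_response S i \<psi> \<xi> z x u \<longleftrightarrow> local_response S i \<psi> \<xi> z' x u"
proof -
  have "(\<lambda>j\<in>neighbors S i. history (dim_x S j) (z j) t) =
      (\<lambda>j\<in>neighbors S i. history (dim_x S j) (z' j) t)" for t
    using assms by (intro restrict_ext) simp
  then have "local_input S i \<psi> \<xi> z t = local_input S i \<psi> \<xi> z' t" for t
    unfolding local_input_def by simp
  moreover have "state_step S i t y (\<lambda>j. block (dim_x S j) (z j) t) v v' =
      state_step S i t y (\<lambda>j. block (dim_x S j) (z' j) t) v v'" for t y v v'
    using assms by (intro state_step_cong) auto
  ultimately show ?thesis
    unfolding local_response_def dynamics_iff_state_step by simp
qed

lemma local_response_exists:
  assumes S: "valid_network S" "i \<in> agents S" and \<psi>: "\<psi> \<in> local_policies S i"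
  shows "\<exists>x u. local_response S i \<psi> \<xi> z x u"
proof -
  define u where "u = stack_blocks (dim_u S i) (horizon S) (local_input S i \<psi> \<xi> z)"
  have "block (dim_u S i) u t = local_input S i \<psi> \<xi> z t" if t: "t \<in> time_steps S" for t
  proof -
    have "history (dim_xi S i) \<xi> (t - 1) \<in> histories (dim_xi S i) (t - 1)"
      by (auto simp: history_def histories_def)
    moreover have "(\<lambda>j\<in>neighbors S i. history (dim_x S j) (z j) t)
        \<in> (\<Pi>\<^sub>E j\<in>neighbors S i. histories (dim_x S j) t)"
      by (auto simp: history_def histories_def)
    moreover have "\<psi> t \<in> histories (dim_xi S i) (t - 1) \<rightarrow>
        (\<Pi>\<^sub>E j\<in>neighbors S i. histories (dim_x S j) t) \<rightarrow> carrier_vec (dim_u S i)"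
      using \<psi> t by (simp add: local_policies_def)
    ultimately have "local_input S i \<psi> \<xi> z t \<in> carrier_vec (dim_u S i)"
      unfolding local_input_def by (blast dest: funcset_mem)
    then show ?thesis
      using block_stack_blocks[of t "horizon S" "local_input S i \<psi> \<xi> z"] t
      by (simp add: u_def time_steps_def)
  qed
  moreover have "u \<in> carrier_vec (len_u S i)"
    unfolding u_def len_u_def by (rule stack_blocks_carrier)
  moreover obtain x where "x \<in> carrier_vec (len_x S i)" "dynamics S i x z u \<xi>"
    using dynamics_solvable[OF S] by blast
  ultimately show ?thesis unfolding local_response_def by blast
qed

text \<open>The state at time \<open>t + 1\<close> reacts to beliefs up to time \<open>t\<close> only; this gain of one time step is
  what drives the induction in \<open>states_in_forecasts\<close>.\<close>

lemma local_response_causal: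
  assumes "local_response S i \<psi> \<xi> z x u" and "local_response S i \<psi> \<xi> z' x' u'"
    and agree: "\<And>j s. j \<in> neighbors S i \<Longrightarrow> s \<in> {1..t} \<Longrightarrow>
      block (dim_x S j) (z j) s = block (dim_x S j) (z' j) s"
    and "s \<in> {1..t + 1}" and "s \<le> horizon S + 1"
  shows "block (dim_x S i) x s = block (dim_x S i) x' s"
  using assms(4,5)
proof (induction s)
  case (Suc s)
  show ?case
  proof (cases "s = 0")
    case True
    then show ?thesis using assms(1,2) by (simp add: local_response_def dynamics_def)
  next
    case False
    then have s: "s \<in> time_steps S" "s \<in> {1..t}" using Suc.prems by (auto simp: time_steps_def)
    have own: "block (dim_x S i) x s = block (dim_x S i) x' s"
      using Suc.IH s by (auto simp: time_steps_def)
    have "(\<lambda>j\<in>neighbors S i. history (dim_x S j) (z j) s) =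
        (\<lambda>j\<in>neighbors S i. history (dim_x S j) (z' j) s)"
      using agree s by (intro restrict_ext) (auto simp: history_eq_iff)
    then have "local_input S i \<psi> \<xi> z s = local_input S i \<psi> \<xi> z' s"
      unfolding local_input_def by simp
    then have input: "block (dim_u S i) u s = block (dim_u S i) u' s"
      using assms(1,2) s by (simp add: local_response_def)
    have "block (dim_x S i) x (s + 1) = state_step S i s (block (dim_x S i) x s)
        (\<lambda>j. block (dim_x S j) (z j) s) (block (dim_u S i) u s) (block (dim_xi S i) \<xi> s)"
      using assms(1) s unfolding local_response_def dynamics_iff_state_step by blast
    also have "\<dots> = state_step S i s (block (dim_x S i) x' s)
        (\<lambda>j. block (dim_x S j) (z' j) s) (block (dim_u S i) u' s) (block (dim_xi S i) \<xi> s)"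
      using agree s own input by (intro state_step_cong) auto
    also have "\<dots> = block (dim_x S i) x' (s + 1)"
      using assms(2) s unfolding local_response_def dynamics_iff_state_step by simp
    finally show ?thesis by simp
  qed
qed simp

text \<open>The induction on time explained at the top. It starts at time zero with arbitrary members of
  the forecast sets, which are nonempty.\<close>

lemma states_in_forecasts:
  assumes S: "valid_network S" and feas: "(\<Psi>, X) \<in> local_feasible S"
    and \<A>: "\<A> \<subseteq> agents S" and closed: "\<And>i. i \<in> \<A> \<Longrightarrow> neighbors S i \<subseteq> \<A>"
    and \<xi>: "\<And>i. i \<in> \<A> \<Longrightarrow> \<xi> i \<in> Xi S i"
    and resp: "\<And>i. i \<in> \<A> \<Longrightarrow> local_response S i (\<Psi> i) (\<xi> i) x (x i) (u i)"
    and i: "i \<in> \<A>"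
  shows "x i \<in> X i"
proof -
  let ?T = "horizon S"
  have X: "X j \<noteq> {}" "X j \<subseteq> carrier_vec (len_x S j)" if "j \<in> \<A>" for j
    using feas \<A> that compactin_subset_topspace[of "vec_topology (len_x S j)" "X j"]
    by (auto simp: local_feasible_def forecast_sets_def)
  have "\<exists>z. \<forall>j\<in>\<A>. z j \<in> X j \<and>
      (\<forall>s\<in>{1..t}. block (dim_x S j) (z j) s = block (dim_x S j) (x j) s)"
    if "t \<le> ?T + 1" for t
    using that
  proof (induction t)
    case 0
    have "\<forall>j\<in>\<A>. \<exists>y. y \<in> X j" using X by blast
    from bchoice[OF this] show ?case by auto
  next
    case (Suc t)
    then obtain z where z: "\<And>j. j \<in> \<A> \<Longrightarrow> z j \<in> X j"
      and agree: "\<And>j s. j \<in> \<A> \<Longrightarrow> s \<in> {1..t} \<Longrightarrow>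
        block (dim_x S j) (z j) s = block (dim_x S j) (x j) s"
      by (metis Suc_leD)
    have "\<exists>y. y \<in> X j \<and> (\<forall>s\<in>{1..Suc t}. block (dim_x S j) y s = block (dim_x S j) (x j) s)"
      if j: "j \<in> \<A>" for j
    proof -
      have agent: "j \<in> agents S" and nbrs: "neighbors S j \<subseteq> \<A>" using \<A> closed j by auto
      have feas_j: "\<Psi> j \<in> local_policies S j"
        "\<And>\<zeta> y v. \<zeta> \<in> (\<Pi>\<^sub>E k\<in>neighbors S j. X k) \<Longrightarrow>
          local_response S j (\<Psi> j) (\<xi> j) \<zeta> y v \<Longrightarrow> y \<in> X j"
        using feas agent \<xi>[OF j] by (auto simp: local_feasible_def)
      \<comment> \<open>Agent \<open>j\<close> reacts to beliefs that agree with the actual neighbor states up to time \<open>t\<close>.\<close>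
      obtain y v where y: "local_response S j (\<Psi> j) (\<xi> j) (restrict z (neighbors S j)) y v"
        using local_response_exists[OF S agent feas_j(1)] by blast
      have "restrict z (neighbors S j) \<in> (\<Pi>\<^sub>E k\<in>neighbors S j. X k)"
        using z nbrs by auto
      then have "y \<in> X j" using feas_j(2) y by blast
      moreover have "block (dim_x S j) y s = block (dim_x S j) (x j) s" if "s \<in> {1..Suc t}" for s
        by (rule local_response_causal[OF y resp[OF j], of t])
          (use agree nbrs that Suc.prems in auto)
      ultimately show ?thesis by blast
    qed
    then have "\<forall>j\<in>\<A>. \<exists>y. y \<in> X j \<and>
        (\<forall>s\<in>{1..Suc t}. block (dim_x S j) y s = block (dim_x S j) (x j) s)" by blast
    from bchoice[OF this] show ?case .
  qed
  then obtain z where z: "z i \<in> X i"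
    and agree: "\<And>s. s \<in> {1..?T + 1} \<Longrightarrow> block (dim_x S i) (z i) s = block (dim_x S i) (x i) s"
    using i by (metis order_refl)
  have "z i \<in> carrier_vec ((?T + 1) * dim_x S i)" "x i \<in> carrier_vec ((?T + 1) * dim_x S i)"
    using z X(2)[OF i] resp[OF i] unfolding local_response_def len_x_def by blast+
  then have "z i = x i" using agree by (rule vec_eq_if_blocks_eq)
  then show ?thesis using z by simp
qed

section \<open>The induced partially nested policies\<close>

text \<open>The observed history of agent \<open>j\<close> lists the disturbances from time 1 on, hence the index
  \<open>s - 1\<close>. For agents and times that \<open>h\<close> does not cover, \<open>h j ! (s - 1)\<close> is an unspecified value;
  by \<open>sim_input_cong\<close> the input is independent of it.\<close>

definition nested_policy :: "network \<Rightarrow> (nat \<Rightarrow> local_policy) \<Rightarrow> nat \<Rightarrow> pn_policy" where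
  "nested_policy S \<Psi> i t h = sim_input S \<Psi> (\<lambda>j s. h j ! (s - 1)) i t"

lemma pn_input_nested_policy:
  "pn_input S i (nested_policy S \<Psi> i) \<xi> t = sim_input S \<Psi> (disturbance_blocks S \<xi>) i t"
  unfolding pn_input_def nested_policy_def
proof (rule sim_input_cong)
  fix j s assume "j \<in> precedents S i" and "s \<in> {1..<t}"
  then show "(\<lambda>j\<in>precedents S i. history (dim_xi S j) (\<xi> j) (t - 1)) j ! (s - 1) =
      disturbance_blocks S \<xi> j s"
    by (auto simp: history_def disturbance_blocks_def simp del: upt_Suc)
qed

lemma nested_policy_in_pn_policies:
  assumes "valid_network S" and "i \<in> agents S" and "\<Psi> i \<in> local_policies S i"
  shows "nested_policy S \<Psi> i \<in> pn_policies S i"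
  unfolding pn_policies_def mem_Collect_eq
proof (intro ballI funcsetI)
  fix t h assume t: "t \<in> time_steps S"
    and "h \<in> (\<Pi>\<^sub>E j\<in>precedents S i. histories (dim_xi S j) (t - 1))"
  then have h: "h i \<in> histories (dim_xi S i) (t - 1)" by auto
  show "nested_policy S \<Psi> i t h \<in> carrier_vec (dim_u S i)"
    unfolding nested_policy_def
  proof (rule sim_input_carrier[of S i \<Psi>, OF assms t])
    fix s assume "s \<in> {1..<t}"
    then have "s - 1 < length (h i)" using h by (auto simp: histories_def)
    then have "h i ! (s - 1) \<in> set (h i)" by simp
    then show "h i ! (s - 1) \<in> carrier_vec (dim_xi S i)" using h by (auto simp: histories_def)
  qed
qed

lemma pn_response_nested_policy_local:
  assumes closed: "\<And>i. i \<in> \<A> \<Longrightarrow> neighbors S i \<subseteq> \<A>"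
    and resp: "pn_response S \<A> (nested_policy S \<Psi>) \<xi> x u" and i: "i \<in> \<A>"
  shows "local_response S i (\<Psi> i) (\<xi> i) x (x i) (u i)"
proof -
  define w where "w = disturbance_blocks S \<xi>"
  have input: "block (dim_u S j) (u j) t = sim_input S \<Psi> w j t"
    if "j \<in> \<A>" "t \<in> time_steps S" for j t
    using resp that by (simp add: pn_response_def pn_input_nested_policy w_def)
  have dyn: "dynamics S j (x j) x (u j) (\<xi> j)" if "j \<in> \<A>" for j
    using resp that by (simp add: pn_response_def)
  have hist: "history (dim_x S j) (x j) (t + 1) = sim_states S \<Psi> w t j"
    if "j \<in> \<A>" "t \<le> horizon S" for j t
    unfolding w_def
    by (rule history_eq_sim_states[of \<A>, OF closed dyn _ that])
      (use input in \<open>auto simp: w_def\<close>)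
  have "block (dim_u S i) (u i) t = local_input S i (\<Psi> i) (\<xi> i) x t" if t: "t \<in> time_steps S" for t
  proof -
    have "history (dim_x S j) (x j) t = sim_states S \<Psi> w (t - 1) j"
      if j: "j \<in> neighbors S i" for j
    proof -
      have "j \<in> \<A>" using j closed[OF i] by blast
      moreover have "t - 1 \<le> horizon S" and "t - 1 + 1 = t" using t by (auto simp: time_steps_def)
      ultimately show ?thesis using hist[of j "t - 1"] by simp
    qed
    then have "local_input S i (\<Psi> i) (\<xi> i) x t = sim_input S \<Psi> w i t"
      using t by (simp add: local_input_eq_feedback_input sim_input_def time_steps_def w_def
          cong: feedback_input_cong)
    then show ?thesis using input[OF i t] by simp
  qed
  then show ?thesis
    using resp dyn[OF i] i by (auto simp: local_response_def pn_response_def PiE_iff)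
qed

text \<open>This is where feasibility and cost are transferred: what holds for all local responses
  to beliefs in the forecast sets holds for the partially nested trajectories.\<close>

lemma pn_response_nested_policy_beliefs:
  assumes S: "valid_network S" and feas: "(\<Psi>, X) \<in> local_feasible S" and i: "i \<in> agents S"
    and \<xi>: "\<xi> \<in> (\<Pi>\<^sub>E j\<in>precedents S i. Xi S j)"
    and resp: "pn_response S (precedents S i) (nested_policy S \<Psi>) \<xi> x u"
  shows "restrict x (neighbors S i) \<in> (\<Pi>\<^sub>E j\<in>neighbors S i. X j)"
    and "local_response S i (\<Psi> i) (\<xi> i) (restrict x (neighbors S i)) (x i) (u i)"
proof -
  let ?A = "precedents S i"
  have loc: "local_response S j (\<Psi> j) (\<xi> j) x (x j) (u j)" if "j \<in> ?A" for j
    using pn_response_nested_policy_local[OF neighbors_subset_precedents resp that] .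
  have "x j \<in> X j" if "j \<in> ?A" for j
    by (rule states_in_forecasts[OF S feas precedents_subset_agents[OF S i]
          neighbors_subset_precedents _ loc that])
      (use \<xi> in auto)
  then show "restrict x (neighbors S i) \<in> (\<Pi>\<^sub>E j\<in>neighbors S i. X j)"
    using neighbors_subset_precedents[OF precedents_refl] by auto
  show "local_response S i (\<Psi> i) (\<xi> i) (restrict x (neighbors S i)) (x i) (u i)"
    using loc[OF precedents_refl]
      local_response_cong[of S i x "restrict x (neighbors S i)"] by auto
qed

lemma nested_policy_feasible:
  assumes S: "valid_network S" and feas: "(\<Psi>, X) \<in> local_feasible S"
  shows "nested_policy S \<Psi> \<in> pn_feasible S"
  unfolding pn_feasible_def mem_Collect_eq
proof (intro ballI conjI allI impI)
  fix i assume i: "i \<in> agents S"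
  then show "nested_policy S \<Psi> i \<in> pn_policies S i"
    using feas by (intro nested_policy_in_pn_policies[OF S]) (auto simp: local_feasible_def)
  fix \<xi> x u
  assume \<xi>: "\<xi> \<in> (\<Pi>\<^sub>E j\<in>precedents S i. Xi S j)"
    and resp: "pn_response S (precedents S i) (nested_policy S \<Psi>) \<xi> x u"
  have "\<xi> i \<in> Xi S i" using \<xi> by auto
  with pn_response_nested_policy_beliefs[OF S feas i \<xi> resp]
  show "(x i, u i) \<in> op_constraints S i"
    using feas i unfolding local_feasible_def by blast
qed

lemma nested_policy_objective_le:
  assumes S: "valid_network S" and feas: "(\<Psi>, X) \<in> local_feasible S"
  shows "pn_objective S (nested_policy S \<Psi>) \<le> local_objective S (\<Psi>, X)"
  unfolding pn_objective_def local_objective_def prod.case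
proof (rule sum_mono, rule Sup_subset_mono, rule subsetI)
  fix i c assume i: "i \<in> agents S"
    and "c \<in> {ereal (agent_cost S i (x i) (u i)) | \<xi> x u. \<xi> \<in> (\<Pi>\<^sub>E j\<in>precedents S i. Xi S j) \<and>
      pn_response S (precedents S i) (nested_policy S \<Psi>) \<xi> x u}"
  then obtain \<xi> x u where c: "c = ereal (agent_cost S i (x i) (u i))"
    and \<xi>: "\<xi> \<in> (\<Pi>\<^sub>E j\<in>precedents S i. Xi S j)"
    and resp: "pn_response S (precedents S i) (nested_policy S \<Psi>) \<xi> x u"
    by blast
  have "\<xi> i \<in> Xi S i" using \<xi> by auto
  with pn_response_nested_policy_beliefs[OF S feas i \<xi> resp] c
  show "c \<in> {ereal (agent_cost S i x u) | \<xi> \<zeta> x u. \<xi> \<in> Xi S i \<and>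
      \<zeta> \<in> (\<Pi>\<^sub>E j\<in>neighbors S i. X j) \<and> local_response S i (\<Psi> i) \<xi> \<zeta> x u}"
    by blast
qed

theorem theorem3:
  fixes S :: network
  assumes "valid_network S"
  shows "(\<forall>(\<Psi>, X)\<in>local_feasible S.
           (\<forall>\<xi>\<in>\<Pi>\<^sub>E i\<in>agents S. carrier_vec (len_xi S i).
              \<exists>!xu. closed_loop S \<Psi> \<xi> (fst xu) (snd xu)) \<and>
           (\<exists>\<Phi>\<in>pn_feasible S.
              \<forall>\<xi>\<in>\<Pi>\<^sub>E i\<in>agents S. carrier_vec (len_xi S i). \<forall>x u.
                closed_loop S \<Psi> \<xi> x u \<longrightarrow>
                (\<forall>i\<in>agents S. \<forall>t\<in>time_steps S.
                   block (dim_u S i) (u i) t = pn_input S i (\<Phi> i) \<xi> t))) \<and>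
         pn_value S \<le> local_value S"
proof (intro conjI ballI, clarify, intro conjI ballI)
  fix \<Psi> X \<xi> assume feas: "(\<Psi>, X) \<in> local_feasible S"
  have "\<exists>x u. closed_loop S \<Psi> \<xi> x u"
    using feas by (intro closed_loop_exists[OF assms]) (auto simp: local_feasible_def)
  then obtain x u where "closed_loop S \<Psi> \<xi> x u" by blast
  then show "\<exists>!xu. closed_loop S \<Psi> \<xi> (fst xu) (snd xu)"
    using closed_loop_unique[OF assms] by (intro ex1I[of _ "(x, u)"]) (auto simp: prod_eq_iff)
next
  fix \<Psi> X assume "(\<Psi>, X) \<in> local_feasible S"
  then show "\<exists>\<Phi>\<in>pn_feasible S.
      \<forall>\<xi>\<in>\<Pi>\<^sub>E i\<in>agents S. carrier_vec (len_xi S i). \<forall>x u. closed_loop S \<Psi> \<xi> x u \<longrightarrow>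
        (\<forall>i\<in>agents S. \<forall>t\<in>time_steps S. block (dim_u S i) (u i) t = pn_input S i (\<Phi> i) \<xi> t)"
    using nested_policy_feasible[OF assms] closed_loop_input[OF assms]
    by (intro bexI[of _ "nested_policy S \<Psi>"]) (auto simp: pn_input_nested_policy)
next
  show "pn_value S \<le> local_value S"
    unfolding pn_value_def local_value_def
  proof (rule INF_greatest)
    fix s assume "s \<in> local_feasible S"
    then show "(INF \<Phi>\<in>pn_feasible S. pn_objective S \<Phi>) \<le> local_objective S s"
      by (cases s) (auto intro: INF_lower2 nested_policy_feasible[OF assms]
          nested_policy_objective_le[OF assms])
  qed
qed

end
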